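(* Let $K=\{1,\dots,k\}$ be a nonempty finite index set and let $f_i:\mathcal{X}\to\mathbb{R}$, $i\in K$, be L$^\natural$-convex functions on a common discrete hyperrectangle $\mathcal{X}\subseteq\mathbb{Z}^n$. Let $$\mathcal{Q}=\{(\mathbf{w},\mathbf{x})\in\mathbb{R}^k\times\mathcal{X}: w_i\ge f_i(\mathbf{x})\ \forall i\in K\},$$ $$\mathcal{CQ}=\{(\mathbf{w},\mathbf{x})\in\mathbb{R}^k\times\overline{\mathcal{X}}: (w_i,\mathbf{x})\in\operatorname{conv}(\mathcal{P}^{f_i}_{\mathcal{X}})\ \forall i\in K\}.$$ Then $\operatorname{conv}(\mathcal{Q})=\mathcal{CQ}$.
   Context: $N=\{1,\dots,n\}$. A discrete hyperrectangle is $\mathcal{X}=\{\mathbf{x}\in\mathbb{Z}^n:\ell_i\le x_i\le u_i\ \forall i\in N\}$ with $\ell_i\in\mathbb{Z}\cup\{-\infty\}$, $u_i\in\mathbb{Z}\cup\{+\infty\}$; $\overline{\mathcal{X}}=\{\mathbf{x}\in\mathbb{R}^n:\ell_i\le x_i\le u_i\ \forall i\in N\}$. $f:\mathcal{X}\to\mathbb{R}$ is L$^\natural$-convex if $f(\mathbf{x})+f(\mathbf{y})\ge f(\lceil(\mathbf{x}+\mathbf{y})/2\rceil)+f(\lfloor(\mathbf{x}+\mathbf{y})/2\rfloor)$ for all $\mathbf{x},\mathbf{y}\in\mathcal{X}$ (component-wise rounding). $\mathcal{P}^{f}_{\mathcal{X}}=\{(w,\mathbf{x})\in\mathbb{R}\times\mathcal{X}:w\ge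 f(\mathbf{x})\}$. *)

theory Defs
  imports "HOL-Analysis.Analysis"
begin

text \<open>
  The index sets \<open>N\<close> and \<open>K\<close> are the finite (hence nonempty) index types \<open>'n\<close> and \<open>'k\<close>.
  The integer lattice is the set of points of \<open>real ^ 'n\<close> with integer coordinates, so that
  convex hulls can be taken in the ambient real space without an embedding. A function on a
  hyperrectangle is a total function on \<open>real ^ 'n\<close>, of which only the values on the
  hyperrectangle are ever used.
\<close>

text \<open>\<open>\<ell>\<^sub>i \<in> \<int> \<union> {-\<infinity>}\<close> and \<open>u\<^sub>i \<in> \<int> \<union> {+\<infinity>}\<close>; the box may be empty.\<close>

definition box_bounds :: "('n::finite \<Rightarrow> ereal) \<Rightarrow> ('n \<Rightarrow> ereal) \<Rightarrow> bool" where
  "box_bounds l u \<longleftrightarrow>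
     (\<forall>i. l i \<in> ereal ` \<int> \<union> {-\<infinity>}) \<and> (\<forall>i. u i \<in> ereal ` \<int> \<union> {\<infinity>})"

definition continuous_box :: "('n::finite \<Rightarrow> ereal) \<Rightarrow> ('n \<Rightarrow> ereal) \<Rightarrow> (real ^ 'n) set" where
  "continuous_box l u = {x. \<forall>i. l i \<le> ereal (x $ i) \<and> ereal (x $ i) \<le> u i}"

definition discrete_box :: "('n::finite \<Rightarrow> ereal) \<Rightarrow> ('n \<Rightarrow> ereal) \<Rightarrow> (real ^ 'n) set" where
  "discrete_box l u =
     {x. (\<forall>i. x $ i \<in> \<int>) \<and> (\<forall>i. l i \<le> ereal (x $ i) \<and> ereal (x $ i) \<le> u i)}"

definition vec_floor :: "real ^ 'n \<Rightarrow> real ^ 'n::finite" where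
  "vec_floor x = (\<chi> i. of_int \<lfloor>x $ i\<rfloor>)"

definition vec_ceiling :: "real ^ 'n \<Rightarrow> real ^ 'n::finite" where
  "vec_ceiling x = (\<chi> i. of_int \<lceil>x $ i\<rceil>)"

text \<open>Meant for hyperrectangles \<open>X\<close>, which are closed under the two rounded midpoints.\<close>

definition L_natural_convex_on :: "(real ^ 'n::finite) set \<Rightarrow> (real ^ 'n \<Rightarrow> real) \<Rightarrow> bool" where
  "L_natural_convex_on X f \<longleftrightarrow>
     (\<forall>x\<in>X. \<forall>y\<in>X. f x + f y \<ge> f (vec_ceiling ((x + y) /\<^sub>R 2)) + f (vec_floor ((x + y) /\<^sub>R 2)))"

definition epi :: "(real ^ 'n::finite) set \<Rightarrow> (real ^ 'n \<Rightarrow> real) \<Rightarrow> (real \<times> (real ^ 'n)) set" where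
  "epi X f = {(w, x). x \<in> X \<and> w \<ge> f x}"

definition joint_epi ::
    "(real ^ 'n::finite) set \<Rightarrow> ('k::finite \<Rightarrow> real ^ 'n \<Rightarrow> real) \<Rightarrow> ((real ^ 'k) \<times> (real ^ 'n)) set" where
  "joint_epi X f = {(w, x). x \<in> X \<and> (\<forall>i. w $ i \<ge> f i x)}"

definition hull_joint_epi ::
    "('n::finite \<Rightarrow> ereal) \<Rightarrow> ('n \<Rightarrow> ereal) \<Rightarrow> ('k::finite \<Rightarrow> real ^ 'n \<Rightarrow> real) \<Rightarrow>
     ((real ^ 'k) \<times> (real ^ 'n)) set" where
  "hull_joint_epi l u f =
     {(w, x). x \<in> continuous_box l u \<and> (\<forall>i. (w $ i, x) \<in> convex hull (epi (discrete_box l u) (f i)))}"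

end

theory Submission
  imports Defs
begin

text \<open>
  The point is that the optimal convex combination of lattice points representing \<open>x\<close> is the
  same for all L-natural-convex functions. Given any such combination, moving equal weight from
  two lattice points to their two rounded midpoints keeps the barycentre and does not increase
  the average of any L-natural-convex function, but strictly decreases the average of a suitable
  quadratic function, unless the two points already differ by a 0/1 vector. Minimising that
  average over a compact slice of a convex hull thus yields a combination supported on points
  that pairwise differ by 0/1 vectors. Such a combination is determined by \<open>x\<close>: its support is a
  chain, and two of them with the same barycentre have supports whose union is again a chain.
  Hence one family of weights serves all the functions simultaneously.
\<close>

section \<open>Lattice points, coordinate forms and adjacency\<close>

definition midpoint_closed :: "(real ^ 'n::finite) set \<Rightarrow> bool" where
  "midpoint_closed X \<longleftrightarrow> (\<forall>x\<in>X. \<forall>y\<in>X.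
     vec_ceiling ((x + y) /\<^sub>R 2) \<in> X \<and> vec_floor ((x + y) /\<^sub>R 2) \<in> X)"

definition integral_points :: "(real ^ 'n::finite) set" where
  "integral_points = {x. \<forall>i. x $ i \<in> \<int>}"

text \<open>The extra coordinate \<open>None\<close> is the constant 0, so that the forms \<open>x\<^sub>i\<close> and \<open>x\<^sub>i - x\<^sub>j\<close>
  are both differences of coordinates.\<close>

fun padded :: "real ^ 'n::finite \<Rightarrow> 'n option \<Rightarrow> real" where
  "padded x None = 0"
| "padded x (Some i) = x $ i"

definition spread :: "real ^ 'n::finite \<Rightarrow> 'n option \<times> 'n option \<Rightarrow> real" where
  "spread x p = padded x (fst p) - padded x (snd p)"

text \<open>Squares of differences are included because squares of coordinates alone need not drop:
  two distinct unit vectors have their sum and 0 as rounded midpoints, with the same total of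
  squared coordinates.\<close>

definition energy :: "real ^ 'n::finite \<Rightarrow> real" where
  "energy x = (\<Sum>p\<in>UNIV. (spread x p)\<^sup>2)"

text \<open>For integral points this says that \<open>x - y\<close> or \<open>y - x\<close> is a 0/1 vector.\<close>

definition adjacent :: "real ^ 'n::finite \<Rightarrow> real ^ 'n \<Rightarrow> bool" where
  "adjacent x y \<longleftrightarrow> (\<forall>p. spread x p - spread y p \<le> 1)"

lemma Ints_less_imp_add_one_le:
  fixes a b :: real
  assumes "a \<in> \<int>" "b \<in> \<int>" "a < b"
  shows "a + 1 \<le> b"
proof -
  obtain m n :: int where "a = of_int m" "b = of_int n"
    using assms(1,2) by (auto elim!: Ints_cases)
  then show ?thesis
    using assms(3) by simp
qed

lemma spread_in_Ints: "x \<in> integral_points \<Longrightarrow> spread x p \<in> \<int>"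
proof -
  assume "x \<in> integral_points"
  then have "padded x a \<in> \<int>" for a
    by (cases a) (auto simp: integral_points_def)
  then show ?thesis
    by (simp add: spread_def)
qed

lemma spread_scaleR_sum: "spread (\<Sum>z\<in>B. u z *\<^sub>R z) p = (\<Sum>z\<in>B. u z * spread z p)"
proof -
  have "padded (\<Sum>z\<in>B. u z *\<^sub>R z) a = (\<Sum>z\<in>B. u z * padded z a)" for a
    by (cases a) auto
  then show ?thesis
    by (simp add: spread_def sum_subtractf right_diff_distrib)
qed

lemma adjacent_sym: "adjacent x y \<Longrightarrow> adjacent y x"
proof -
  have *: "spread x (prod.swap p) = - spread x p" for x :: "real ^ 'n" and p
    by (simp add: spread_def)
  assume "adjacent x y"
  then have "spread x (prod.swap p) - spread y (prod.swap p) \<le> 1" for p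
    unfolding adjacent_def by blast
  then show ?thesis
    unfolding adjacent_def * by (auto simp: algebra_simps)
qed

text \<open>If coordinates \<open>i\<close> and \<open>j\<close> were ordered oppositely, each would
  contribute at least 1 to the gap of the form \<open>x $ i - x $ j\<close>, making it at least
  2.\<close>

lemma adjacent_imp_comparable:
  assumes "adjacent x y" "x \<in> integral_points" "y \<in> integral_points"
  shows "x \<le> y \<or> y \<le> x"
proof (rule ccontr)
  assume "\<not> ?thesis"
  then obtain i j where ij: "x $ i > y $ i" "y $ j > x $ j"
    by (auto simp: less_eq_vec_def not_le)
  have "x $ i - y $ i \<ge> 1" "y $ j - x $ j \<ge> 1"
    using ij assms(2,3) Ints_less_imp_add_one_le[of "y $ i" "x $ i"]
      Ints_less_imp_add_one_le[of "x $ j" "y $ j"]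
    by (auto simp: integral_points_def)
  moreover have "spread x (Some i, Some j) - spread y (Some i, Some j) \<le> 1"
    using assms(1) unfolding adjacent_def by blast
  ultimately show False
    by (simp add: spread_def)
qed

section \<open>Uncrossing two lattice points\<close>

text \<open>A number in {-1, 0, 1} has the least absolute value in its residue class modulo 2. This
  is the arithmetic source of the energy drop.\<close>

lemma square_add_even:
  fixes b k :: int
  assumes "\<bar>b\<bar> \<le> 1"
  shows "b\<^sup>2 \<le> (b + 2 * k)\<^sup>2" "1 < b + 2 * k \<Longrightarrow> b\<^sup>2 < (b + 2 * k)\<^sup>2"
proof -
  have "\<bar>b\<bar> \<le> \<bar>b + 2 * k\<bar>"
    using assms by presburger
  then show "b\<^sup>2 \<le> (b + 2 * k)\<^sup>2"
    by (simp add: abs_le_square_iff)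
  assume "1 < b + 2 * k"
  then have "\<bar>b\<bar> < \<bar>b + 2 * k\<bar>"
    using assms by linarith
  then show "b\<^sup>2 < (b + 2 * k)\<^sup>2"
    by (metis abs_le_square_iff linorder_not_le)
qed

text \<open>Here \<open>e\<close> is the parity of \<open>a + b\<close>, so rounding moves the
  half-sum by \<open>e / 2\<close>; \<open>a - b\<close> has the same parity, which yields
  \<open>k\<close>.\<close>

lemma rounded_halves:
  fixes a b :: real
  assumes "a \<in> \<int>" "b \<in> \<int>"
  obtains e k :: int where "e = 0 \<or> e = 1"
    "of_int \<lceil>(a + b) / 2\<rceil> = (a + b + of_int e) / 2"
    "of_int \<lfloor>(a + b) / 2\<rfloor> = (a + b - of_int e) / 2"
    "a - b = of_int (e + 2 * k)"
proof -
  obtain m n where mn: "a = of_int m" "b = of_int n"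
    using assms by (auto elim!: Ints_cases)
  define e where "e = (m + n) mod 2"
  define q where "q = (m + n) div 2"
  have s: "m + n = 2 * q + e"
    by (simp add: e_def q_def)
  have e: "e = 0 \<or> e = 1"
    unfolding e_def by presburger
  have "a + b = 2 * of_int q + of_int e"
    using s mn by (metis of_int_add of_int_mult of_int_numeral)
  then have h: "(a + b) / 2 = of_int q + of_int e / 2"
    by simp
  have "\<lfloor>(a + b) / 2\<rfloor> = q"
    unfolding h using e by (intro floor_unique) auto
  moreover have "\<lceil>(a + b) / 2\<rceil> = q + e"
    unfolding h using e by (intro ceiling_unique) auto
  moreover have "m - n = e + 2 * (q - n)"
    using s by simp
  then have "a - b = of_int (e + 2 * (q - n))"
    using mn by (metis of_int_diff)
  ultimately show thesis
    using that[of e "q - n"] e h by simp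
qed

lemma vec_rounded_midpoint:
  "vec_ceiling ((x + y) /\<^sub>R 2) $ i = of_int \<lceil>(x $ i + y $ i) / 2\<rceil>"
  "vec_floor ((x + y) /\<^sub>R 2) $ i = of_int \<lfloor>(x $ i + y $ i) / 2\<rfloor>"
  by (simp_all add: vec_ceiling_def vec_floor_def)

lemma energy_uncross:
  fixes x y :: "real ^ 'n::finite"
  assumes "x \<in> integral_points" "y \<in> integral_points"
  defines "c \<equiv> vec_ceiling ((x + y) /\<^sub>R 2)" and "d \<equiv> vec_floor ((x + y) /\<^sub>R 2)"
  shows "c + d = x + y" and "\<not> adjacent x y \<Longrightarrow> energy c + energy d < energy x + energy y"
proof -
  have "\<exists>e k :: int. (e = 0 \<or> e = 1) \<and> padded c a = (padded x a + padded y a + of_int e) / 2 \<and>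
      padded d a = (padded x a + padded y a - of_int e) / 2 \<and>
      padded x a - padded y a = of_int (e + 2 * k)" for a
  proof (cases a)
    case None
    then show ?thesis
      by (intro exI[of _ 0]) auto
  next
    case (Some i)
    have "x $ i \<in> \<int>" "y $ i \<in> \<int>"
      using assms by (auto simp: integral_points_def)
    then obtain e k :: int where "e = 0 \<or> e = 1" "c $ i = (x $ i + y $ i + of_int e) / 2"
      "d $ i = (x $ i + y $ i - of_int e) / 2" "x $ i - y $ i = of_int (e + 2 * k)"
      unfolding c_def d_def vec_rounded_midpoint by (rule rounded_halves)
    then show ?thesis
      unfolding Some padded.simps by blast
  qed
  then obtain e k :: "'n option \<Rightarrow> int" where e: "\<And>a. e a = 0 \<or> e a = 1"
    and c: "\<And>a. padded c a = (padded x a + padded y a + of_int (e a)) / 2"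
    and d: "\<And>a. padded d a = (padded x a + padded y a - of_int (e a)) / 2"
    and xy: "\<And>a. padded x a - padded y a = of_int (e a + 2 * k a)"
    by metis
  have "c $ i + d $ i = x $ i + y $ i" for i
    using c[of "Some i"] d[of "Some i"] by (simp add: field_simps)
  then show "c + d = x + y"
    by (simp add: vec_eq_iff)
  \<comment> \<open>A form is a difference of two coordinates, so its parity term \<open>b p\<close>
    lies in {-1, 0, 1}.\<close>
  define b where "b p = e (fst p) - e (snd p)" for p
  define m where "m p = k (fst p) - k (snd p)" for p
  have b: "\<bar>b p\<bar> \<le> 1" for p
    using e[of "fst p"] e[of "snd p"] by (auto simp: b_def)
  have diff: "spread x p - spread y p = of_int (b p + 2 * m p)" for p
    using xy[of "fst p"] xy[of "snd p"] by (simp add: spread_def b_def m_def algebra_simps)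
  \<comment> \<open>Parallelogram law: both pairs have the same sum under the form, and its values
    at \<open>c\<close> and \<open>d\<close> differ by exactly \<open>b p\<close>.\<close>
  have gap: "(spread x p)\<^sup>2 + (spread y p)\<^sup>2 - ((spread c p)\<^sup>2 + (spread d p)\<^sup>2)
      = (of_int ((b p + 2 * m p)\<^sup>2) - of_int ((b p)\<^sup>2)) / 2" for p
  proof -
    have mid: "spread c p = (spread x p + spread y p + of_int (b p)) / 2"
      "spread d p = (spread x p + spread y p - of_int (b p)) / 2"
      by (simp_all add: spread_def c d b_def field_simps)
    have "(spread x p)\<^sup>2 + (spread y p)\<^sup>2 - ((spread c p)\<^sup>2 + (spread d p)\<^sup>2)
        = ((spread x p - spread y p)\<^sup>2 - (of_int (b p))\<^sup>2) / 2"
      unfolding mid by (simp add: power2_eq_square field_simps)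
    then show ?thesis
      by (simp add: diff)
  qed
  assume "\<not> adjacent x y"
  then obtain p where "1 < b p + 2 * m p"
    unfolding adjacent_def diff by (metis not_le of_int_1 of_int_less_iff)
  then have "of_int ((b p)\<^sup>2) < (of_int ((b p + 2 * m p)\<^sup>2) :: real)"
    using square_add_even(2)[OF b] by (simp only: of_int_less_iff)
  then have "0 < (spread x p)\<^sup>2 + (spread y p)\<^sup>2 - ((spread c p)\<^sup>2 + (spread d p)\<^sup>2)"
    unfolding gap by simp
  then have "(spread c p)\<^sup>2 + (spread d p)\<^sup>2 < (spread x p)\<^sup>2 + (spread y p)\<^sup>2"
    by simp
  moreover have "(spread c p)\<^sup>2 + (spread d p)\<^sup>2 \<le> (spread x p)\<^sup>2 + (spread y p)\<^sup>2" for p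
  proof -
    have "of_int ((b p)\<^sup>2) \<le> (of_int ((b p + 2 * m p)\<^sup>2) :: real)"
      using square_add_even(1)[OF b] by (simp only: of_int_le_iff)
    then have "0 \<le> (spread x p)\<^sup>2 + (spread y p)\<^sup>2 - ((spread c p)\<^sup>2 + (spread d p)\<^sup>2)"
      unfolding gap by simp
    then show ?thesis
      by simp
  qed
  ultimately have "(\<Sum>p\<in>UNIV. (spread c p)\<^sup>2 + (spread d p)\<^sup>2)
      < (\<Sum>p\<in>UNIV. (spread x p)\<^sup>2 + (spread y p)\<^sup>2)"
    by (intro sum_strict_mono_ex1 ballI bexI[of _ p]) simp_all
  then show "energy c + energy d < energy x + energy y"
    by (simp add: energy_def sum.distrib)
qed

section \<open>Finite convex combinations and energy minimisation\<close>

text \<open>Weights are indexed by the points of \<open>B\<close> rather than by their images, so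
  \<open>g\<close> may identify points and weights for different functions can be compared.\<close>

lemma convex_hull_image_finite:
  fixes g :: "'a \<Rightarrow> 'b::real_vector"
  assumes "finite B"
  shows "convex hull (g ` B) = {\<Sum>z\<in>B. u z *\<^sub>R g z | u. (\<forall>z\<in>B. 0 \<le> u z) \<and> sum u B = 1}"
    (is "_ = ?R")
proof (rule hull_unique)
  show "g ` B \<subseteq> ?R"
  proof
    fix v assume "v \<in> g ` B"
    then obtain z where z: "z \<in> B" "v = g z"
      by auto
    then show "v \<in> ?R"
      using assms by (intro CollectI exI[of _ "\<lambda>y. if y = z then 1 else 0"])
        (auto simp: if_distrib[of "\<lambda>c. c *\<^sub>R _"] cong: if_cong)
  qed
  show "convex ?R"
  proof (rule convexI)
    fix v w and s t :: real
    assume "v \<in> ?R" "w \<in> ?R" and st: "0 \<le> s" "0 \<le> t" "s + t = 1"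
    then obtain a b where a: "\<forall>z\<in>B. 0 \<le> a z" "sum a B = 1" "v = (\<Sum>z\<in>B. a z *\<^sub>R g z)"
      and b: "\<forall>z\<in>B. 0 \<le> b z" "sum b B = 1" "w = (\<Sum>z\<in>B. b z *\<^sub>R g z)"
      by auto
    have "sum (\<lambda>z. s * a z + t * b z) B = 1"
      using a b st by (simp add: sum.distrib flip: sum_distrib_left)
    then show "s *\<^sub>R v + t *\<^sub>R w \<in> ?R"
      using a b st by (intro CollectI exI[of _ "\<lambda>z. s * a z + t * b z"])
        (auto simp: sum.distrib scaleR_right.sum scaleR_left_distrib)
  qed
  fix T assume T: "g ` B \<subseteq> T" "convex T"
  then show "?R \<subseteq> T"
    using assms by (auto intro!: convex_sum)
qed

lemma weights_uncross:
  fixes g :: "'a \<Rightarrow> 'b::real_vector"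
  assumes "finite B" "\<forall>z\<in>B. 0 \<le> u z" "sum u B = 1"
    and "x \<in> B" "y \<in> B" "c \<in> B" "d \<in> B" "x \<noteq> y" "u x > 0" "u y > 0"
  obtains r where "r > 0"
    "(\<Sum>z\<in>B. u z *\<^sub>R g z) + r *\<^sub>R (g c + g d - (g x + g y)) \<in> convex hull (g ` B)"
proof -
  \<comment> \<open>The largest amount that can be taken from both \<open>x\<close> and
    \<open>y\<close> without a negative weight.\<close>
  define r where "r = min (u x) (u y)"
  \<comment> \<open>Adding indicators covers the cases where \<open>c\<close> and \<open>d\<close>
    coincide with each other or with \<open>x\<close> or \<open>y\<close>.\<close>
  define i :: "'a \<Rightarrow> 'a \<Rightarrow> real" where "i a z = (if z = a then 1 else 0)" for a z
  define v where "v z = u z + r * (i c z + i d z - (i x z + i y z))" for z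
  have i: "(\<Sum>z\<in>B. i a z *\<^sub>R h z) = h a" if "a \<in> B" for a and h :: "'a \<Rightarrow> 'c::real_vector"
    using that assms(1) by (simp add: i_def if_distrib[of "\<lambda>c. c *\<^sub>R _"] cong: if_cong)
  \<comment> \<open>With \<open>h\<close> constantly 1 this gives the total mass, with
    \<open>h = g\<close> the new point.\<close>
  have v: "(\<Sum>z\<in>B. v z *\<^sub>R h z) = (\<Sum>z\<in>B. u z *\<^sub>R h z) + r *\<^sub>R (h c + h d - (h x + h y))"
    for h :: "'a \<Rightarrow> 'c::real_vector"
    using assms(4-7)
    by (simp add: v_def i scaleR_left_distrib scaleR_left_diff_distrib sum.distrib sum_subtractf
        flip: scaleR_scaleR scaleR_right.sum)
  have "sum v B = 1"
    using v[of "\<lambda>_. 1 :: real"] assms(3) by simp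
  moreover have "0 \<le> v z" if "z \<in> B" for z
    using assms that by (auto simp: v_def i_def r_def min_def algebra_simps)
  ultimately have "(\<Sum>z\<in>B. v z *\<^sub>R g z) \<in> convex hull (g ` B)"
    unfolding convex_hull_image_finite[OF assms(1)] by blast
  moreover have "r > 0"
    using assms by (simp add: r_def)
  ultimately show thesis
    using that v[of g] by simp
qed

lemma adjacent_weights_exist:
  fixes f :: "real ^ 'n::finite \<Rightarrow> real"
  assumes B: "finite B" "B \<subseteq> integral_points" "midpoint_closed B"
    and f: "L_natural_convex_on B f"
    and cx: "(c, x) \<in> convex hull ((\<lambda>z. (f z, z)) ` B)"
  obtains u where "\<forall>z\<in>B. 0 \<le> u z" "sum u B = 1" "(\<Sum>z\<in>B. u z *\<^sub>R z) = x"
    "(\<Sum>z\<in>B. u z * f z) \<le> c" "\<And>y z. \<lbrakk>y \<in> B; z \<in> B; u y > 0; u z > 0\<rbrakk> \<Longrightarrow> adjacent y z"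
proof -
  \<comment> \<open>Carrying the energy as an extra coordinate makes its average a linear function
    on a compact hull.\<close>
  define g where "g z = (energy z, f z, z)" for z
  \<comment> \<open>The value of \<open>f\<close> is only bounded by \<open>c\<close>, not fixed, so
    that uncrossing cannot leave the slice.\<close>
  define H where "H = convex hull (g ` B) \<inter> {q. fst (snd q) \<le> c \<and> snd (snd q) = x}"
  have "compact (convex hull (g ` B))"
    using B by (intro finite_imp_compact_convex_hull) auto
  moreover have "closed {q :: real \<times> real \<times> (real ^ 'n). fst (snd q) \<le> c \<and> snd (snd q) = x}"
    by (intro closed_Collect_conj closed_Collect_le closed_Collect_eq continuous_intros)
  ultimately have "compact H"
    unfolding H_def by (rule compact_Int_closed)
  \<comment> \<open>Forgetting the energy maps the lifted hull onto the given one, so some lift of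
    \<open>(c, x)\<close> lies in \<open>H\<close>.\<close>
  moreover have "(\<lambda>z. (f z, z)) ` B = snd ` g ` B"
    by (simp add: g_def image_image)
  then have "(c, x) \<in> snd ` (convex hull (g ` B))"
    using cx by (simp add: convex_hull_linear_image linear_snd)
  then have "H \<noteq> {}"
    unfolding H_def by force
  ultimately have "\<exists>q\<in>H. \<forall>q'\<in>H. fst q \<le> fst q'"
    by (rule continuous_attains_inf) (intro continuous_intros)
  then obtain q where q: "q \<in> H" "\<forall>q'\<in>H. fst q \<le> fst q'"
    by blast
  then have "q \<in> convex hull (g ` B)"
    by (simp add: H_def)
  then obtain u where u: "\<forall>z\<in>B. 0 \<le> u z" "sum u B = 1" "q = (\<Sum>z\<in>B. u z *\<^sub>R g z)"
    unfolding convex_hull_image_finite[OF B(1)] by blast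
  have "fst (snd q) = (\<Sum>z\<in>B. u z * f z)" "snd (snd q) = (\<Sum>z\<in>B. u z *\<^sub>R z)"
    by (simp_all add: u(3) fst_sum snd_sum g_def)
  then have val: "(\<Sum>z\<in>B. u z * f z) \<le> c" "(\<Sum>z\<in>B. u z *\<^sub>R z) = x"
    using q(1) by (simp_all add: H_def)
  have "adjacent y z" if yz: "y \<in> B" "z \<in> B" "u y > 0" "u z > 0" for y z
  proof (rule ccontr)
    assume nadj: "\<not> adjacent y z"
    then have "y \<noteq> z"
      by (auto simp: adjacent_def)
    define a where "a = vec_ceiling ((y + z) /\<^sub>R 2)"
    define b where "b = vec_floor ((y + z) /\<^sub>R 2)"
    have ab: "a \<in> B" "b \<in> B"
      using B(3) yz unfolding midpoint_closed_def a_def b_def by blast+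
    have "f a + f b \<le> f y + f z"
      using f yz unfolding L_natural_convex_on_def a_def b_def by blast
    moreover have "a + b = y + z" "energy a + energy b < energy y + energy z"
      using energy_uncross[of y z] B(2) yz nadj unfolding a_def b_def by blast+
    moreover obtain r where r: "r > 0"
      "q + r *\<^sub>R (g a + g b - (g y + g z)) \<in> convex hull (g ` B)"
      using weights_uncross[OF B(1) u(1,2) yz(1,2) ab \<open>y \<noteq> z\<close> yz(3,4), of g]
      unfolding u(3) by blast
    moreover have "r * (f a + f b - (f y + f z)) \<le> 0" "r * (energy a + energy b - (energy y + energy z)) < 0"
      using calculation by (simp_all add: mult_le_0_iff mult_less_0_iff)
    \<comment> \<open>The shift keeps the barycentre and does not raise the value of
      \<open>f\<close>, yet it lowers the minimal energy.\<close>
    ultimately have "q + r *\<^sub>R (g a + g b - (g y + g z)) \<in> H"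
      and less: "fst (q + r *\<^sub>R (g a + g b - (g y + g z))) < fst q"
      using q(1) unfolding H_def g_def by auto
    then show False
      using q(2) by force
  qed
  then show thesis
    using that u val by blast
qed

section \<open>Uniqueness of adjacent weights\<close>

lemma weighted_sum_less:
  fixes u h :: "'a \<Rightarrow> real"
  assumes "finite B" "\<forall>z\<in>B. 0 \<le> u z" "sum u B = 1"
    and "\<And>z. z \<in> B \<Longrightarrow> u z > 0 \<Longrightarrow> h z \<le> c" and "y \<in> B" "u y > 0" "h y < c"
  shows "(\<Sum>z\<in>B. u z * h z) < c"
proof -
  have "(\<Sum>z\<in>B. u z * h z) < (\<Sum>z\<in>B. u z * c)"
  proof (rule sum_strict_mono_ex1)
    show "\<forall>z\<in>B. u z * h z \<le> u z * c"
    proof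
      fix z assume "z \<in> B"
      then show "u z * h z \<le> u z * c"
        using assms(2,4) by (cases "u z = 0") (auto simp: less_le mult_left_mono)
    qed
    show "\<exists>z\<in>B. u z * h z < u z * c"
      using assms(5-7) by (intro bexI[of _ y] mult_strict_left_mono)
  qed (fact assms(1))
  then show ?thesis
    using assms(3) by (simp flip: sum_distrib_right)
qed

text \<open>The points with differing weights form a chain that carries a linear dependence with
  coefficients summing to 0. Some coordinate is larger at the top point than at all others, where it
  is constant, and this forces the top coefficient to vanish.\<close>

lemma adjacent_weights_unique:
  fixes u v :: "real ^ 'n::finite \<Rightarrow> real"
  assumes B: "finite B" "B \<subseteq> integral_points"
    and u: "\<forall>z\<in>B. 0 \<le> u z" "sum u B = 1"
      "\<And>y z. \<lbrakk>y \<in> B; z \<in> B; u y > 0; u z > 0\<rbrakk> \<Longrightarrow> adjacent y z"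
    and v: "\<forall>z\<in>B. 0 \<le> v z" "sum v B = 1"
      "\<And>y z. \<lbrakk>y \<in> B; z \<in> B; v y > 0; v z > 0\<rbrakk> \<Longrightarrow> adjacent y z"
    and eq: "(\<Sum>z\<in>B. u z *\<^sub>R z) = (\<Sum>z\<in>B. v z *\<^sub>R z)"
    and "z \<in> B"
  shows "u z = v z"
proof (rule ccontr)
  assume "u z \<noteq> v z"
  txt \<open>If a form exceeds its value at \<open>y\<close> by at least 2 at \<open>x\<close>, then its \<open>u\<close>-average and its
    \<open>v\<close>-average are separated strictly by an intermediate value, although they are equal.\<close>
  have mixed: "adjacent x y" if x: "x \<in> B" "u x > 0" and y: "y \<in> B" "v y > 0" for x y
    unfolding adjacent_def
  proof (rule allI, rule ccontr)
    fix p assume "\<not> spread x p - spread y p \<le> 1"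
    moreover have "spread x p \<in> \<int>" "spread y p \<in> \<int>"
      using spread_in_Ints B(2) x y by blast+
    \<comment> \<open>Integrality widens a gap above 1 to at least 2, so the two one-unit
      neighbourhoods below overlap in at most a boundary value.\<close>
    ultimately have two: "spread x p - spread y p \<ge> 2"
      using Ints_less_imp_add_one_le[of "spread y p + 1" "spread x p"] by simp
    \<comment> \<open>Negated to turn a lower bound into an upper one; strictness comes from
      \<open>x\<close> itself, which clears the bound by 1.\<close>
    have "(\<Sum>z\<in>B. u z * (- spread z p)) < - (spread x p - 1)"
    proof (rule weighted_sum_less[OF B(1) u(1,2) _ x])
      fix z assume "z \<in> B" "u z > 0"
      with u(3) x have "spread x p - spread z p \<le> 1"
        unfolding adjacent_def by blast
      then show "- spread z p \<le> - (spread x p - 1)"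
        by simp
    qed simp
    moreover have "(\<Sum>z\<in>B. v z * spread z p) < spread y p + 1"
    proof (rule weighted_sum_less[OF B(1) v(1,2) _ y])
      fix z assume "z \<in> B" "v z > 0"
      with v(3) y have "spread z p - spread y p \<le> 1"
        unfolding adjacent_def by blast
      then show "spread z p \<le> spread y p + 1"
        by simp
    qed simp
    ultimately show False
      using two arg_cong[OF eq, of "\<lambda>x. spread x p"] by (simp add: spread_scaleR_sum sum_negf)
  qed
  define D where "D = {z \<in> B. u z \<noteq> v z}"
  have D: "finite D" "D \<subseteq> B"
    using B by (auto simp: D_def)
  have pos: "u x > 0 \<or> v x > 0" if "x \<in> D" for x
    using that u(1) v(1) by (force simp: D_def)
  have adj: "adjacent x y" if "x \<in> D" "y \<in> D" for x y
  proof -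
    have "x \<in> B" "y \<in> B"
      using that D by auto
    then show ?thesis
      using pos[OF that(1)] pos[OF that(2)]
      by (auto intro: u(3) v(3) mixed adjacent_sym[OF mixed])
  qed
  have comp: "x \<le> y \<or> y \<le> x" if "x \<in> D" "y \<in> D" for x y
    by (rule adjacent_imp_comparable) (use adj that D(2) B(2) in auto)
  \<comment> \<open>In a finite chain a maximal element is greatest. This is applied to
    \<open>D\<close> and then to \<open>D - {m}\<close>.\<close>
  have top: "\<exists>m\<in>A. \<forall>z\<in>A. z \<le> m" if A: "A \<subseteq> D" "A \<noteq> {}" for A
  proof -
    have "finite A"
      using A(1) D(1) by (rule finite_subset)
    then obtain m where m: "m \<in> A" "\<forall>z\<in>A. m \<le> z \<longrightarrow> m = z"
      using finite_has_maximal[OF _ A(2)] by blast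
    have "z \<le> m" if "z \<in> A" for z
      using comp[of z m] m that A(1) by auto
    then show ?thesis
      using m(1) by blast
  qed
  define w where "w z = u z - v z" for z
  have sum_w: "(\<Sum>z\<in>D. w z *\<^sub>R h z) = (\<Sum>z\<in>B. u z *\<^sub>R h z) - (\<Sum>z\<in>B. v z *\<^sub>R h z)"
    for h :: "real ^ 'n \<Rightarrow> 'c::real_vector"
  proof -
    have "(\<Sum>z\<in>D. w z *\<^sub>R h z) = (\<Sum>z\<in>B. w z *\<^sub>R h z)"
      using D B(1) by (intro sum.mono_neutral_left) (auto simp: D_def w_def)
    then show ?thesis
      by (simp add: w_def scaleR_left_diff_distrib sum_subtractf)
  qed
  have mass: "sum w D = 0"
    using sum_w[of "\<lambda>_. 1 :: real"] u(2) v(2) by simp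
  have bary: "(\<Sum>z\<in>D. w z * z $ i) = 0" for i
    using sum_w[of "\<lambda>z. z $ i"] arg_cong[OF eq, of "\<lambda>x. x $ i"] by simp
  obtain m where m: "m \<in> D" "\<forall>z\<in>D. z \<le> m"
    using top[of D] \<open>z \<in> B\<close> \<open>u z \<noteq> v z\<close> by (auto simp: D_def)
  have wm: "w m \<noteq> 0"
    using m by (simp add: D_def w_def)
  have split: "sum h D = h m + sum h (D - {m})" for h :: "real ^ 'n \<Rightarrow> real"
    using D(1) m(1) by (rule sum.remove)
  have "D - {m} \<noteq> {}"
  proof
    assume "D - {m} = {}"
    then have "D = {m}"
      using m(1) by blast
    then show False
      using mass wm by simp
  qed
  \<comment> \<open>The second largest point \<open>m'\<close> dominates all others, so one
    coordinate separating it from \<open>m\<close> separates them all.\<close>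
  then obtain m' where m': "m' \<in> D - {m}" "\<forall>z\<in>D - {m}. z \<le> m'"
    using top[of "D - {m}"] by blast
  then have "m' \<le> m" "m' \<noteq> m"
    using m by auto
  then obtain i where i: "m' $ i < m $ i"
    by (metis less_eq_vec_def order_less_le vec_eq_iff)
  have ints: "z $ i \<in> \<int>" if "z \<in> D" for z
    using that D B(2) by (auto simp: integral_points_def)
  have near: "m $ i - z $ i \<le> 1" if "z \<in> D" for z
  proof -
    \<comment> \<open>Pairing with \<open>None\<close> reduces the form to the bare coordinate
      \<open>i\<close>.\<close>
    have "spread m (Some i, None) - spread z (Some i, None) \<le> 1"
      using adj[OF m(1) that] unfolding adjacent_def by blast
    then show ?thesis
      by (simp add: spread_def)
  qed
  have step: "m $ i = m' $ i + 1"
  proof -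
    have "m $ i - m' $ i \<le> 1" "m $ i \<in> \<int>" "m' $ i \<in> \<int>"
      using near ints m m' by auto
    with i show ?thesis
      using Ints_less_imp_add_one_le[of "m' $ i" "m $ i"] by simp
  qed
  txt \<open>Coordinate \<open>i\<close> is constant on \<open>D - {m}\<close>, so the balance of the barycentres isolates \<open>w m\<close>.\<close>
  have "z $ i = m' $ i" if "z \<in> D - {m}" for z
  proof (rule antisym)
    show "z $ i \<le> m' $ i"
      using m'(2) that by (auto simp: less_eq_vec_def)
    show "m' $ i \<le> z $ i"
      using near[of z] that step by simp
  qed
  then have "(\<Sum>z\<in>D. w z * (z $ i - m' $ i)) = w m"
    using step by (simp add: split)
  moreover have "(\<Sum>z\<in>D. w z * (z $ i - m' $ i)) = 0"
    using bary[of i] mass by (simp add: right_diff_distrib sum_subtractf flip: sum_distrib_right)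
  ultimately show False
    using wm by simp
qed

section \<open>Reduction to finitely many lattice points\<close>

text \<open>Pushing each point of a finite combination down onto the graph lowers only the first
  coordinate of the average.\<close>

lemma mem_convex_hull_epi_finite:
  assumes "(w, x) \<in> convex hull (epi X f)"
  obtains c T where "c \<le> w" "finite T" "T \<subseteq> X" "(c, x) \<in> convex hull ((\<lambda>z. (f z, z)) ` T)"
proof -
  obtain S u where S: "finite S" "S \<subseteq> epi X f" and u: "\<forall>s\<in>S. 0 \<le> u s" "sum u S = 1"
    and wx: "(\<Sum>s\<in>S. u s *\<^sub>R s) = (w, x)"
    using assms unfolding convex_hull_explicit by auto
  define c where "c = (\<Sum>s\<in>S. u s * f (snd s))"
  have "c \<le> (\<Sum>s\<in>S. u s * fst s)"
    unfolding c_def using S u by (intro sum_mono mult_left_mono) (auto simp: epi_def)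
  also have "\<dots> = w"
    using arg_cong[OF wx, of fst] by (simp add: fst_sum)
  finally have "c \<le> w" .
  moreover have "(\<Sum>s\<in>S. u s *\<^sub>R snd s) = x"
    using arg_cong[OF wx, of snd] by (simp add: snd_sum)
  then have "(c, x) = (\<Sum>s\<in>S. u s *\<^sub>R (f (snd s), snd s))"
    by (simp add: c_def prod_eq_iff fst_sum snd_sum)
  then have "(c, x) \<in> convex hull ((\<lambda>s. (f (snd s), snd s)) ` S)"
    unfolding convex_hull_image_finite[OF S(1)] using u by blast
  moreover have "snd ` S \<subseteq> X"
    using S(2) by (auto simp: epi_def)
  ultimately show thesis
    using that[of c "snd ` S"] S(1) by (simp add: image_image)
qed

text \<open>Rounding cannot cross an integer, so a symmetric interval with integer ends survives
  it.\<close>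

lemma abs_rounded_half_le:
  fixes a b M :: real
  assumes "M \<in> \<int>" "\<bar>a\<bar> \<le> M" "\<bar>b\<bar> \<le> M"
  shows "\<bar>of_int \<lceil>(a + b) / 2\<rceil>\<bar> \<le> M" "\<bar>of_int \<lfloor>(a + b) / 2\<rfloor>\<bar> \<le> M"
proof -
  obtain m where m: "M = of_int m"
    using assms(1) by (rule Ints_cases)
  have "- of_int m \<le> (a + b) / 2" "(a + b) / 2 \<le> of_int m"
    using assms m by auto
  then have "\<lceil>(a + b) / 2\<rceil> \<le> m" "- m \<le> \<lfloor>(a + b) / 2\<rfloor>"
    by (simp_all add: ceiling_le_iff le_floor_iff)
  moreover have "\<lfloor>(a + b) / 2\<rfloor> \<le> \<lceil>(a + b) / 2\<rceil>"
    by (rule floor_le_ceiling)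
  ultimately have "\<bar>\<lceil>(a + b) / 2\<rceil>\<bar> \<le> m" "\<bar>\<lfloor>(a + b) / 2\<rfloor>\<bar> \<le> m"
    by linarith+
  then show "\<bar>of_int \<lceil>(a + b) / 2\<rceil>\<bar> \<le> M" "\<bar>of_int \<lfloor>(a + b) / 2\<rfloor>\<bar> \<le> M"
    unfolding m by (metis of_int_abs of_int_le_iff)+
qed

lemma finite_integral_box:
  "finite {x :: real ^ 'n::finite. x \<in> integral_points \<and> (\<forall>i. \<bar>x $ i\<bar> \<le> M)}"
proof (rule finite_subset)
  let ?A = "{a :: real. a \<in> \<int> \<and> \<bar>a\<bar> \<le> M}"
  show "finite (vec_lambda ` (UNIV \<rightarrow>\<^sub>E ?A) :: (real ^ 'n) set)"
    by (intro finite_imageI finite_PiE finite_abs_int_segment) simp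
  show "{x :: real ^ 'n. x \<in> integral_points \<and> (\<forall>i. \<bar>x $ i\<bar> \<le> M)} \<subseteq> vec_lambda ` (UNIV \<rightarrow>\<^sub>E ?A)"
  proof
    fix x :: "real ^ 'n"
    assume "x \<in> {x. x \<in> integral_points \<and> (\<forall>i. \<bar>x $ i\<bar> \<le> M)}"
    then have "vec_nth x \<in> UNIV \<rightarrow>\<^sub>E ?A"
      by (auto simp: integral_points_def)
    then show "x \<in> vec_lambda ` (UNIV \<rightarrow>\<^sub>E ?A)"
      by (intro image_eqI[of _ _ "vec_nth x"]) simp_all
  qed
qed

text \<open>Intersecting \<open>X\<close> with a large enough cube with integer bounds keeps
  midpoint closure, and the integrality of \<open>X\<close> makes the result finite.\<close>

lemma finite_midpoint_closed_superset:
  fixes X :: "(real ^ 'n::finite) set"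
  assumes "finite T" "T \<subseteq> X" "X \<subseteq> integral_points" "midpoint_closed X"
  obtains B where "finite B" "T \<subseteq> B" "B \<subseteq> X" "midpoint_closed B"
proof -
  have "bdd_above ((\<lambda>(x, i). \<bar>x $ i\<bar>) ` (T \<times> UNIV))"
    using assms(1) by (intro bdd_above_finite) simp
  then obtain m where m: "\<And>x i. x \<in> T \<Longrightarrow> \<bar>x $ i\<bar> \<le> m"
    unfolding bdd_above_def by fastforce
  define M :: real where "M = of_int \<lceil>m\<rceil>"
  define B where "B = {x \<in> X. \<forall>i. \<bar>x $ i\<bar> \<le> M}"
  have "finite B"
    using assms(3) by (intro finite_subset[OF _ finite_integral_box[of M]]) (auto simp: B_def)
  moreover have "T \<subseteq> B"
    using assms(2) m by (auto simp: B_def M_def intro: order_trans[OF _ le_of_int_ceiling])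
  moreover have "midpoint_closed B"
    unfolding midpoint_closed_def
  proof (intro ballI conjI)
    fix x y assume xy: "x \<in> B" "y \<in> B"
    have "\<bar>x $ i\<bar> \<le> M" "\<bar>y $ i\<bar> \<le> M" "M \<in> \<int>" for i
      using xy by (simp_all add: B_def M_def)
    then show "vec_ceiling ((x + y) /\<^sub>R 2) \<in> B" "vec_floor ((x + y) /\<^sub>R 2) \<in> B"
      using xy assms(4) abs_rounded_half_le unfolding B_def midpoint_closed_def mem_Collect_eq
      by (metis vec_rounded_midpoint)+
  qed
  ultimately show thesis
    using that by (auto simp: B_def)
qed

section \<open>One family of weights for all functions\<close>

lemma mem_convex_hull_joint_epi:
  fixes X :: "(real ^ 'n::finite) set" and f :: "'k::finite \<Rightarrow> real ^ 'n \<Rightarrow> real"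
  assumes X: "X \<subseteq> integral_points" "midpoint_closed X"
    and f: "\<And>i. L_natural_convex_on X (f i)"
    and wx: "\<And>i. (w $ i, x) \<in> convex hull (epi X (f i))"
  shows "(w, x) \<in> convex hull (joint_epi X f)"
proof -
  have "\<forall>i. \<exists>c T. c \<le> w $ i \<and> finite T \<and> T \<subseteq> X \<and> (c, x) \<in> convex hull ((\<lambda>z. (f i z, z)) ` T)"
    (is "\<forall>i. \<exists>c T. ?P i c T")
  proof
    show "\<exists>c T. ?P i c T" for i
      by (rule mem_convex_hull_epi_finite[OF wx[of i]]) (intro exI conjI)
  qed
  then obtain c T where c: "\<And>i. c i \<le> w $ i" and T: "\<And>i. finite (T i)" "\<And>i. T i \<subseteq> X"
    and cx: "\<And>i. (c i, x) \<in> convex hull ((\<lambda>z. (f i z, z)) ` T i)"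
    unfolding choice_iff by blast
  \<comment> \<open>A single \<open>B\<close> for all indices lets the weight families be compared
    on one domain.\<close>
  obtain B where B: "finite B" "(\<Union>i. T i) \<subseteq> B" "B \<subseteq> X" "midpoint_closed B"
  proof (rule finite_midpoint_closed_superset)
    show "finite (\<Union>i. T i)"
      using T(1) by simp
    show "(\<Union>i. T i) \<subseteq> X"
      using T(2) by blast
  qed (use X in auto)
  have B_int: "B \<subseteq> integral_points"
    using B X by blast
  have "\<forall>i. \<exists>u. (\<forall>z\<in>B. 0 \<le> u z) \<and> sum u B = 1 \<and> (\<Sum>z\<in>B. u z *\<^sub>R z) = x \<and>
      (\<Sum>z\<in>B. u z * f i z) \<le> c i \<and> (\<forall>y\<in>B. \<forall>z\<in>B. u y > 0 \<longrightarrow> u z > 0 \<longrightarrow> adjacent y z)"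
    (is "\<forall>i. ?P i")
  proof
    fix i
    have "L_natural_convex_on B (f i)"
      using f B(3) by (auto simp: L_natural_convex_on_def)
    moreover have "(c i, x) \<in> convex hull ((\<lambda>z. (f i z, z)) ` B)"
      by (rule subsetD[OF hull_mono cx[of i]]) (use B(2) in blast)
    ultimately obtain u where "\<forall>z\<in>B. 0 \<le> u z" "sum u B = 1" "(\<Sum>z\<in>B. u z *\<^sub>R z) = x"
        "(\<Sum>z\<in>B. u z * f i z) \<le> c i"
        "\<And>y z. \<lbrakk>y \<in> B; z \<in> B; u y > 0; u z > 0\<rbrakk> \<Longrightarrow> adjacent y z"
      using adjacent_weights_exist[OF B(1) B_int B(4)] by blast
    then show "?P i"
      by (intro exI[of _ u] conjI ballI impI) blast+
  qed
  then obtain u where u: "\<And>i. \<forall>z\<in>B. 0 \<le> u i z" "\<And>i. sum (u i) B = 1"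
      "\<And>i. (\<Sum>z\<in>B. u i z *\<^sub>R z) = x" "\<And>i. (\<Sum>z\<in>B. u i z * f i z) \<le> c i"
      "\<And>i y z. \<lbrakk>y \<in> B; z \<in> B; u i y > 0; u i z > 0\<rbrakk> \<Longrightarrow> adjacent y z"
    unfolding choice_iff by blast
  \<comment> \<open>The index \<open>undefined\<close> is an arbitrary element of the nonempty index
    type.\<close>
  define v where "v = u undefined"
  have "u i z = v z" if "z \<in> B" for i z
  proof (rule adjacent_weights_unique[OF B(1) B_int _ _ _ _ _ _ _ that])
    show "(\<Sum>z\<in>B. u i z *\<^sub>R z) = (\<Sum>z\<in>B. v z *\<^sub>R z)"
      using u(3)[of i] u(3)[of undefined] by (simp add: v_def)
  qed (use u(1,2,5) in \<open>auto simp: v_def\<close>)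
  then have v: "(\<Sum>z\<in>B. v z * f i z) \<le> w $ i" for i
    using u(4)[of i] c[of i] by simp
  \<comment> \<open>The slack between \<open>w\<close> and the common average. Added to every graph
    point, it stays in the epigraphs since \<open>s\<close> is nonnegative, and it corrects the
    average to exactly \<open>w\<close> since the weights sum to 1.\<close>
  define s where "s = (\<chi> i. w $ i - (\<Sum>z\<in>B. v z * f i z))"
  define F where "F z = ((\<chi> i. f i z) + s, z)" for z
  have "F ` B \<subseteq> joint_epi X f"
    using B(3) v by (auto simp: F_def s_def joint_epi_def)
  moreover have "(\<Sum>z\<in>B. v z *\<^sub>R F z) \<in> convex hull (F ` B)"
    unfolding convex_hull_image_finite[OF B(1)] using u(1,2) v_def by blast
  moreover have "(\<Sum>z\<in>B. v z *\<^sub>R F z) = (w, x)"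
    using u(2,3)[of undefined]
    by (simp add: prod_eq_iff fst_sum snd_sum F_def v_def vec_eq_iff s_def distrib_left sum.distrib
        flip: sum_distrib_right)
  ultimately show ?thesis
    by (metis hull_mono subsetD)
qed

section \<open>Hyperrectangles and the two inclusions\<close>

lemma convex_continuous_box: "convex (continuous_box l u)"
proof -
  have "continuous_box l u = (\<Inter>i. (\<lambda>x. x $ i) -` {t. l i \<le> ereal t \<and> ereal t \<le> u i})"
    by (auto simp: continuous_box_def)
  moreover have "convex {t. a \<le> ereal t \<and> ereal t \<le> b}" for a b
  proof -
    have "is_interval {t. a \<le> ereal t \<and> ereal t \<le> b}"
      unfolding is_interval_1
    proof (intro ballI allI impI)
      fix s t r
      assume "s \<in> {t. a \<le> ereal t \<and> ereal t \<le> b}" "t \<in> {t. a \<le> ereal t \<and> ereal t \<le> b}"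
        and "s \<le> r \<and> r \<le> t"
      then show "r \<in> {t. a \<le> ereal t \<and> ereal t \<le> b}"
        using order_trans[of a "ereal s" "ereal r"] order_trans[of "ereal r" "ereal t" b] by simp
    qed
    then show ?thesis
      by (rule is_interval_convex)
  qed
  moreover have "linear (\<lambda>x :: real ^ 'a. x $ i)" for i
    by (intro linearI) auto
  ultimately show ?thesis
    by (simp only:) (intro convex_INT convex_linear_vimage)
qed

lemma midpoint_closed_discrete_box:
  assumes "box_bounds l u"
  shows "midpoint_closed (discrete_box l u)"
proof -
  \<comment> \<open>Rounding down threatens only the lower bound, and it cannot cross a bound that
    is an integer or infinite; rounding up is symmetric.\<close>
  have lower: "l i \<le> ereal (of_int \<lfloor>t\<rfloor>)" if "l i \<le> ereal t" for i t
  proof (cases "l i = -\<infinity>")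
    case False
    then obtain k where "l i = ereal (of_int k)"
      using assms by (auto simp: box_bounds_def elim!: Ints_cases)
    then show ?thesis
      using that by (simp add: le_floor_iff)
  qed simp
  have upper: "ereal (of_int \<lceil>t\<rceil>) \<le> u i" if "ereal t \<le> u i" for i t
  proof (cases "u i = \<infinity>")
    case False
    then obtain k where "u i = ereal (of_int k)"
      using assms by (auto simp: box_bounds_def elim!: Ints_cases)
    then show ?thesis
      using that by (simp add: ceiling_le_iff)
  qed simp
  have bounds: "l i \<le> ereal (of_int \<lceil>t\<rceil>)" "ereal (of_int \<lceil>t\<rceil>) \<le> u i"
      "l i \<le> ereal (of_int \<lfloor>t\<rfloor>)" "ereal (of_int \<lfloor>t\<rfloor>) \<le> u i"
    if "l i \<le> ereal t" "ereal t \<le> u i" for i t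
    using lower upper that order_trans[of "l i" "ereal t"] order_trans[of _ "ereal t" "u i"]
    by auto
  \<comment> \<open>The unrounded midpoint obeys the bounds because the continuous box is
    convex.\<close>
  have mid: "l i \<le> ereal ((x $ i + y $ i) / 2) \<and> ereal ((x $ i + y $ i) / 2) \<le> u i"
    if "x \<in> discrete_box l u" "y \<in> discrete_box l u" for x y i
  proof -
    have "x \<in> continuous_box l u" "y \<in> continuous_box l u"
      using that by (auto simp: discrete_box_def continuous_box_def)
    then have "(1 / 2) *\<^sub>R x + (1 / 2) *\<^sub>R y \<in> continuous_box l u"
      by (intro convexD[OF convex_continuous_box]) auto
    then show ?thesis
      by (auto simp: continuous_box_def add_divide_distrib)
  qed
  show ?thesis
    unfolding midpoint_closed_def
  proof (intro ballI conjI)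
    fix x y assume "x \<in> discrete_box l u" "y \<in> discrete_box l u"
    then show "vec_ceiling ((x + y) /\<^sub>R 2) \<in> discrete_box l u"
      "vec_floor ((x + y) /\<^sub>R 2) \<in> discrete_box l u"
      using mid bounds unfolding discrete_box_def mem_Collect_eq vec_rounded_midpoint by auto
  qed
qed

theorem proposition4p1:
  fixes l u :: "'n::finite \<Rightarrow> ereal"
    and f :: "'k::finite \<Rightarrow> real ^ 'n \<Rightarrow> real"
  assumes "box_bounds l u"
    and "\<And>i. L_natural_convex_on (discrete_box l u) (f i)"
  shows "convex hull (joint_epi (discrete_box l u) f) = hull_joint_epi l u f"
proof
  let ?X = "discrete_box l u"
  show "convex hull (joint_epi ?X f) \<subseteq> hull_joint_epi l u f"
  proof clarify
    fix w x assume wx: "(w, x) \<in> convex hull (joint_epi ?X f)"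
    have "x \<in> convex hull (snd ` joint_epi ?X f)"
      using in_convex_hull_linear_image[OF linear_snd wx] by simp
    moreover have "snd ` joint_epi ?X f \<subseteq> continuous_box l u"
      by (auto simp: joint_epi_def discrete_box_def continuous_box_def)
    ultimately have "x \<in> continuous_box l u"
      by (meson convex_continuous_box hull_minimal subsetD)
    moreover have "(w $ i, x) \<in> convex hull (epi ?X (f i))" for i
    proof -
      \<comment> \<open>This linear projection keeps one component of \<open>w\<close>; it carries
        hulls to hulls and the joint epigraph into that of \<open>f i\<close>.\<close>
      let ?p = "\<lambda>q :: (real ^ 'k) \<times> (real ^ 'n). (fst q $ i, snd q)"
      have "linear ?p"
        by (intro linearI) auto
      from in_convex_hull_linear_image[OF this wx]
      have "(w $ i, x) \<in> convex hull (?p ` joint_epi ?X f)"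
        by simp
      moreover have "?p ` joint_epi ?X f \<subseteq> epi ?X (f i)"
        by (auto simp: joint_epi_def epi_def)
      ultimately show ?thesis
        using hull_mono by blast
    qed
    ultimately show "(w, x) \<in> hull_joint_epi l u f"
      by (simp add: hull_joint_epi_def)
  qed
  have "?X \<subseteq> integral_points"
    by (auto simp: discrete_box_def integral_points_def)
  then have "(w, x) \<in> convex hull (joint_epi ?X f)" if "(w, x) \<in> hull_joint_epi l u f" for w x
    using midpoint_closed_discrete_box[OF assms(1)] assms(2)
    by (rule mem_convex_hull_joint_epi) (use that in \<open>auto simp: hull_joint_epi_def\<close>)
  then show "hull_joint_epi l u f \<subseteq> convex hull (joint_epi ?X f)"
    by auto
qed

end
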